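(* Let $n\ge 1$ be an integer and let $G$ be a finite group isomorphic to the generalized quaternion group $Q_{2^{n+2}}$ of order $2^{n+2}$. Then $|\mathrm{Im}\, g_1|=n$, i.e. the set $\{csd(H)\mid H\in L(G)\}$ has exactly $n$ elements.
   Context: For a finite group $G$, $L(G)$ denotes the set of all subgroups of $G$ and $L_1(G)$ the set of all cyclic subgroups of $G$. The cyclic subgroup commutativity degree of a finite group $H$ is $$csd(H)=\frac{1}{|L_1(H)|^2}\left|\{(A,B)\in L_1(H)^2 \mid AB=BA\}\right|.$$ The function $g_1:L(G)\to[0,1]$ is given by $g_1(H)=csd(H)$ for all $H\in L(G)$. For $m\ge 3$, $Q_{2^m}=\langle x,y \mid x^{2^{m-1}}=y^4=1,\ x^{2^{m-2}}=y^2,\ yxy^{-1}=x^{2^{m-1}-1}\rangle$ is the generalized quaternion group of order $2^m$. *)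

theory Defs
  imports "HOL-Algebra.Algebra"
begin

text \<open>
  A word in the generators is a list of letters; the letter \<open>(g, True)\<close> stands for the
  generator \<open>g\<close> and \<open>(g, False)\<close> for its formal inverse. A relation \<open>u = v\<close> is the pair
  \<open>(u, v)\<close>. The type \<open>'g\<close> is the set of generators.
\<close>

type_synonym 'g gword = "('g \<times> bool) list"

inductive word_eq :: "('g gword \<times> 'g gword) set \<Rightarrow> 'g gword \<Rightarrow> 'g gword \<Rightarrow> bool"
  for R where
  refl: "word_eq R u u"
| sym: "word_eq R u v \<Longrightarrow> word_eq R v u"
| trans: "word_eq R u v \<Longrightarrow> word_eq R v w \<Longrightarrow> word_eq R u w"
| append: "word_eq R u u' \<Longrightarrow> word_eq R v v' \<Longrightarrow> word_eq R (u @ v) (u' @ v')"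
| cancel: "word_eq R [(g, b), (g, \<not> b)] []"
| rel: "(u, v) \<in> R \<Longrightarrow> word_eq R u v"

definition word_class :: "('g gword \<times> 'g gword) set \<Rightarrow> 'g gword \<Rightarrow> 'g gword set"
  where "word_class R u = {v. word_eq R u v}"

definition presented_group :: "('g gword \<times> 'g gword) set \<Rightarrow> 'g gword set monoid"
  where "presented_group R =
    \<lparr>carrier = range (word_class R),
     monoid.mult = (\<lambda>A B. {w. \<exists>u\<in>A. \<exists>v\<in>B. word_eq R (u @ v) w}),
     one = word_class R []\<rparr>"

lemma word_class_eq_iff: "word_class R u = word_class R v \<longleftrightarrow> word_eq R u v"
  unfolding word_class_def
  by (auto intro: word_eq.refl word_eq.sym word_eq.trans)

lemma carrier_presented_group: "carrier (presented_group R) = range (word_class R)"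
  by (simp add: presented_group_def)

lemma one_presented_group: "\<one>\<^bsub>presented_group R\<^esub> = word_class R []"
  by (simp add: presented_group_def)

lemma mult_presented_group:
  "word_class R u \<otimes>\<^bsub>presented_group R\<^esub> word_class R v = word_class R (u @ v)"
  unfolding presented_group_def word_class_def
  by (auto intro: word_eq.refl word_eq.trans word_eq.append)

lemma word_eq_inverse: "word_eq R (rev (map (\<lambda>(g, b). (g, \<not> b)) u) @ u) []"
proof (induction u)
  case Nil
  then show ?case by (simp add: word_eq.refl)
next
  case (Cons a u)
  obtain g b where a: "a = (g, b)" by (cases a)
  let ?i = "rev (map (\<lambda>(g, b). (g, \<not> b)) u)"
  have "word_eq R (?i @ ([(g, \<not> b), (g, \<not> \<not> b)] @ u)) (?i @ ([] @ u))"
    by (intro word_eq.append word_eq.refl word_eq.cancel)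
  then show ?case using Cons.IH a by (auto intro: word_eq.trans)
qed

lemma group_presented_group: "group (presented_group R)"
proof (rule groupI)
  fix a assume "a \<in> carrier (presented_group R)"
  then obtain u where a: "a = word_class R u" by (auto simp: carrier_presented_group)
  show "\<exists>b\<in>carrier (presented_group R). b \<otimes>\<^bsub>presented_group R\<^esub> a = \<one>\<^bsub>presented_group R\<^esub>"
    using word_eq_inverse[of R u] unfolding a carrier_presented_group one_presented_group
    by (metis mult_presented_group rangeI word_class_eq_iff)
qed (auto simp: carrier_presented_group one_presented_group mult_presented_group)

datatype quat_gen = GenX | GenY

abbreviation (input) wx :: "quat_gen gword" where "wx \<equiv> [(GenX, True)]"
abbreviation (input) wy :: "quat_gen gword" where "wy \<equiv> [(GenY, True)]"
abbreviation (input) wy_inv :: "quat_gen gword" where "wy_inv \<equiv> [(GenY, False)]"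

abbreviation (input) wpow :: "'g gword \<Rightarrow> nat \<Rightarrow> 'g gword"
  where "wpow u k \<equiv> concat (replicate k u)"

text \<open>\<open>gen_quaternion m\<close> is the group \<open>Q\<close> of order \<open>2 ^ m\<close>; it is meant for \<open>m \<ge> 3\<close>.\<close>

definition gen_quaternion :: "nat \<Rightarrow> quat_gen gword set monoid"
  where "gen_quaternion m = presented_group
    {(wpow wx (2 ^ (m - 1)), []),
     (wpow wy 4, []),
     (wpow wx (2 ^ (m - 2)), wpow wy 2),
     (wy @ wx @ wy_inv, wpow wx (2 ^ (m - 1) - 1))}"

definition subgroups_of :: "('a, 'b) monoid_scheme \<Rightarrow> 'a set set"
  where "subgroups_of G = {H. subgroup H G}"

definition cyclic_subgroups_of :: "('a, 'b) monoid_scheme \<Rightarrow> 'a set set"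
  where "cyclic_subgroups_of G = {H. subgroup H G \<and> cyclic_group (G\<lparr>carrier := H\<rparr>)}"

definition csd :: "('a, 'b) monoid_scheme \<Rightarrow> real"
  where "csd G =
    1 / (real (card (cyclic_subgroups_of G)))\<^sup>2 *
    real (card {(A, B). A \<in> cyclic_subgroups_of G \<and> B \<in> cyclic_subgroups_of G \<and>
                        A <#>\<^bsub>G\<^esub> B = B <#>\<^bsub>G\<^esub> A})"

definition g1 :: "('a, 'b) monoid_scheme \<Rightarrow> 'a set \<Rightarrow> real"
  where "g1 G H = csd (G\<lparr>carrier := H\<rparr>)"

end

theory Submission
  imports Defs
begin

text \<open>
  Write the elements of \<open>Q = Q\<^bsub>2^(n+2)\<^esub>\<close> as \<open>x^i\<close> and \<open>x^i y\<close>, with \<open>i\<close> an integer modulo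
  \<open>2^(n+1)\<close>; they multiply by
  \<open>x^i x^j = x^(i+j)\<close>, \<open>x^i (x^j y) = x^(i+j) y\<close>, \<open>(x^i y) x^j = x^(i-j) y\<close> and
  \<open>(x^i y) (x^j y) = x^(i-j+2^n)\<close>. The cyclic subgroups of \<open>Q\<close> are the \<open>n + 2\<close> subgroups of
  \<open>\<langle>x\<rangle>\<close>, all normal in \<open>Q\<close> and hence commuting with everything, and the \<open>N = 2^n\<close> subgroups
  \<open>\<langle>x^i y\<rangle>\<close> of order four, \<open>i\<close> taken modulo \<open>N\<close>. Every \<open>\<langle>x^i y\<rangle>\<close> contains the centre
  \<open>{1, x^N}\<close>, so the product of \<open>\<langle>x^i y\<rangle>\<close> and \<open>\<langle>x^j y\<rangle>\<close> meets \<open>\<langle>x\<rangle>\<close> in the classes of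
  \<open>0\<close> and \<open>i - j\<close> modulo \<open>N\<close>; reversing the order changes \<open>i - j\<close> into \<open>j - i\<close>, and the two
  subgroups commute iff \<open>N\<close> divides \<open>2 (i - j)\<close>. Hence each one commutes with exactly two of
  its kind, so that \<open>N (N - 2)\<close> ordered pairs fail to commute and

  \<open>csd Q = 1 - N (N - 2) / (n + 2 + N)\<^sup>2\<close>    (\<open>csd_eq\<close>).

  A subgroup of \<open>Q\<close> is contained in a cyclic group, and then has degree 1, or it is generated by
  some \<open>x^(2^j)\<close> and \<open>x^i y\<close> with \<open>j < n\<close>. These two generators satisfy the same relations with
  \<open>n - j\<close> in place of \<open>n\<close> (\<open>subgroup_cases\<close>, \<open>quaternion_basis_subgroup\<close>), so the formula
  applies to the subgroup as well. The value at \<open>n = 1\<close> is 1, so the degrees that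
  occur are exactly the values of the formula at \<open>1, \<dots>, n\<close> (\<open>g1_image\<close>). The formula is strictly
  decreasing, so these values are distinct.

  For the presented group the only point that does not follow by manipulating the relations is
  that \<open>x^(2^n)\<close> is nontrivial. This is seen in the action on pairs of complex numbers in which
  \<open>x\<close> multiplies the two coordinates by \<open>w\<close> and \<open>1/w\<close>, where \<open>w\<close> is a primitive
  \<open>2^(n+1)\<close>-th root of unity, and \<open>y\<close> sends \<open>(a, b)\<close> to \<open>(-b, a)\<close>: there \<open>x^(2^n)\<close> acts as \<open>-1\<close>.
\<close>

section \<open>Cyclic subgroups and abelian groups\<close>

lemma (in group) cyclic_subgroups_of_eq:
  "cyclic_subgroups_of G = (\<lambda>a. generate G {a}) ` carrier G"
proof -
  have range: "generate G {a} = range (\<lambda>k::int. a [^] k)" if "a \<in> carrier G" for a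
    using generate_pow[OF that] by auto
  have cyc: "cyclic_group (G\<lparr>carrier := H\<rparr>) \<longleftrightarrow> (\<exists>a\<in>H. H = generate G {a})"
    if H: "subgroup H G" for H
  proof -
    interpret H: group "G\<lparr>carrier := H\<rparr>" by (rule subgroup_imp_group[OF H])
    have "range (\<lambda>k::int. a [^]\<^bsub>G\<lparr>carrier := H\<rparr>\<^esub> k) = generate G {a}" if "a \<in> H" for a
      using range[of a] subgroup.subset[OF H] int_pow_consistent[OF H that] that by auto
    then show ?thesis
      unfolding H.cyclic_group by auto
  qed
  show ?thesis
  proof (intro equalityI subsetI)
    fix H assume "H \<in> cyclic_subgroups_of G"
    then show "H \<in> (\<lambda>a. generate G {a}) ` carrier G"
      using cyc[of H] subgroup.subset[of H G] by (auto simp: cyclic_subgroups_of_def)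
  next
    fix H assume "H \<in> (\<lambda>a. generate G {a}) ` carrier G"
    then obtain a where a: "a \<in> carrier G" "H = generate G {a}" by auto
    then have "subgroup H G" "a \<in> H"
      using generate_is_subgroup[of "{a}"] generate.incl[of a "{a}"] by auto
    then show "H \<in> cyclic_subgroups_of G"
      using cyc a unfolding cyclic_subgroups_of_def by auto
  qed
qed

lemma (in group) finite_cyclic_subgroups_of:
  "finite (carrier G) \<Longrightarrow> finite (cyclic_subgroups_of G)"
  unfolding cyclic_subgroups_of_eq by simp

lemma (in comm_group) csd_eq_1:
  assumes "finite (carrier G)"
  shows "csd G = 1"
proof -
  let ?C = "cyclic_subgroups_of G"
  have "A <#> B = B <#> A" if "A \<in> ?C" "B \<in> ?C" for A B
  proof -
    have "A \<subseteq> carrier G" "B \<subseteq> carrier G"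
      using that subgroup.subset by (auto simp: cyclic_subgroups_of_def)
    then have comm: "a \<otimes> b = b \<otimes> a" if "a \<in> A" "b \<in> B" for a b
      using that m_comm by blast
    have "A <#> B = (\<Union>a\<in>A. \<Union>b\<in>B. {b \<otimes> a})"
      unfolding set_mult_def by (intro SUP_cong arg_cong[where f = "\<lambda>c. {c}"] comm HOL.refl)
    also have "\<dots> = B <#> A"
      unfolding set_mult_def by (rule SUP_commute)
    finally show ?thesis .
  qed
  then have "{(A, B). A \<in> ?C \<and> B \<in> ?C \<and> A <#> B = B <#> A} = ?C \<times> ?C"
    by auto
  moreover have "card ?C \<noteq> 0"
    using finite_cyclic_subgroups_of[OF assms] one_closed
    by (auto simp: cyclic_subgroups_of_eq)
  ultimately show ?thesis
    unfolding csd_def by (simp add: card_cartesian_product power2_eq_square)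
qed

text \<open>
  Besides the subgroups of \<open>\<langle>x\<rangle>\<close> this covers the subgroups of order four generated by some
  \<open>x^i y\<close>, which lie outside the quaternion family.
\<close>
lemma (in group) g1_subgroup_of_cyclic:
  assumes "finite (carrier G)" "subgroup H G" "a \<in> carrier G" "H \<subseteq> generate G {a}"
  shows "g1 G H = 1"
proof -
  interpret H: group "G\<lparr>carrier := H\<rparr>" by (rule subgroup_imp_group[OF assms(2)])
  have comm: "b \<otimes> c = c \<otimes> b" if bc: "b \<in> H" "c \<in> H" for b c
  proof -
    obtain k l :: int where "b = a [^] k" "c = a [^] l"
      using bc assms(4) generate_pow[OF assms(3)] by blast
    then show ?thesis
      using assms(3) by (simp add: int_pow_mult[symmetric] add.commute)
  qed
  have "comm_group (G\<lparr>carrier := H\<rparr>)"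
    by (rule H.group_comm_groupI) (simp add: comm)
  moreover have "finite H"
    using assms(1,2) subgroup.subset finite_subset by blast
  ultimately show ?thesis
    unfolding g1_def by (simp add: comm_group.csd_eq_1)
qed

section \<open>The count of commuting pairs and the resulting values\<close>

text \<open>
  Given \<open>i\<close>, the condition says that \<open>j\<close> has the same remainder as \<open>i\<close> modulo \<open>h\<close>, and each
  remainder occurs twice below \<open>2 h\<close>.
\<close>
lemma card_pairs_congruent_mod_half:
  assumes "h > 0"
  shows "card {(i, j). i < 2 * h \<and> j < 2 * h \<and> int (2 * h) dvd 2 * (int i - int j)} = 4 * h"
proof -
  have *: "{j. j < 2 * h \<and> i mod h = j mod h} = {i mod h, i mod h + h}" for i
  proof (intro equalityI subsetI)
    fix j assume "j \<in> {j. j < 2 * h \<and> i mod h = j mod h}"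
    then have j: "j < 2 * h" "i mod h = j mod h" by auto
    show "j \<in> {i mod h, i mod h + h}"
    proof (cases "j < h")
      case True
      with j show ?thesis by simp
    next
      case False
      then have "j mod h = (j - h) mod h" by (simp add: le_mod_geq)
      with False j show ?thesis by simp
    qed
  next
    fix j assume "j \<in> {i mod h, i mod h + h}"
    moreover have "i mod h < h" using assms by simp
    ultimately show "j \<in> {j. j < 2 * h \<and> i mod h = j mod h}" by auto
  qed
  have "int (2 * h) dvd 2 * (int i - int j) \<longleftrightarrow> i mod h = j mod h" for i j
  proof -
    have "int (2 * h) dvd 2 * (int i - int j) \<longleftrightarrow> int h dvd int i - int j"
      by (simp only: of_nat_mult of_nat_numeral dvd_times_left_cancel_iff)
    also have "\<dots> \<longleftrightarrow> int (i mod h) = int (j mod h)"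
      by (simp add: mod_eq_dvd_iff zmod_int)
    finally show ?thesis by simp
  qed
  then have "{(i, j). i < 2 * h \<and> j < 2 * h \<and> int (2 * h) dvd 2 * (int i - int j)}
    = Sigma {..<2 * h} (\<lambda>i. {j. j < 2 * h \<and> i mod h = j mod h})"
    by auto
  then show ?thesis using assms by (simp add: *)
qed

text \<open>
  The degree of the generalized quaternion group of order \<open>2^(n+2)\<close>, in the form
  that exhibits the proportion of noncommuting pairs.
\<close>
definition csd_quaternion :: "nat \<Rightarrow> real" where
  "csd_quaternion n = 1 - 2 ^ n * (2 ^ n - 2) / (real n + 2 + 2 ^ n)\<^sup>2"

text \<open>
  With \<open>N = 2^n\<close> and \<open>d = n + 2 + N\<close>, both \<open>N / d\<close> and \<open>(N - 2) / d\<close> increase with \<open>n\<close>,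
  because \<open>N\<close> and \<open>N - 2\<close> at least double in each step while \<open>d\<close> less than doubles; their
  product is what is subtracted from 1.
\<close>
lemma csd_quaternion_less_Suc:
  assumes "n \<ge> 1"
  shows "csd_quaternion (Suc n) < csd_quaternion n"
proof -
  (* Passing from n to n + 1 replaces N by 2 N, hence d by d'. *)
  define N :: real where "N = 2 ^ n"
  define d where "d = real n + 2 + N"
  define d' where "d' = real n + 3 + 2 * N"
  have N: "N \<ge> 2"
    unfolding N_def using power_increasing[OF assms, of "2::real"] by simp
  then have d: "d > 0" "d' > 0" by (simp_all add: d_def d'_def)
  have "N / d < 2 * N / d'"
    using N d by (simp add: field_simps) (simp add: d_def d'_def)
  moreover have "(N - 2) / d < (2 * N - 2) / d'"
  proof -
    have "(2 * N - 2) * d - (N - 2) * d' = 3 * N + N * real n + 2"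
      by (simp add: d_def d'_def algebra_simps)
    moreover have "N * real n \<ge> 0" using N by simp
    ultimately have "(N - 2) * d' < (2 * N - 2) * d" using N by linarith
    then show ?thesis using d by (simp only: divide_less_eq less_divide_eq) (simp add: field_simps)
  qed
  ultimately have "N / d * ((N - 2) / d) < 2 * N / d' * ((2 * N - 2) / d')"
    using N d by (intro mult_strict_mono) auto
  then show ?thesis
    by (simp add: csd_quaternion_def d_def d'_def N_def power2_eq_square algebra_simps)
qed

lemma inj_on_csd_quaternion: "inj_on csd_quaternion {1..n}"
proof -
  have "strict_mono (\<lambda>k. - csd_quaternion (Suc k))"
    by (simp add: strict_mono_Suc_iff csd_quaternion_less_Suc)
  then have *: "k = l" if "csd_quaternion (Suc k) = csd_quaternion (Suc l)" for k l
    using strict_mono_eq[of "\<lambda>k. - csd_quaternion (Suc k)" k l] that by simp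
  show ?thesis
  proof (rule inj_onI)
    fix i j assume "i \<in> {1..n}" "j \<in> {1..n}" "csd_quaternion i = csd_quaternion j"
    then show "i = j" using *[of "i - 1" "j - 1"] by (cases i; cases j) auto
  qed
qed

section \<open>Arithmetic in a generalized quaternion group\<close>

text \<open>
  A pair of generators with the relations of the generalized quaternion group of order
  \<open>2^(n+2)\<close>. Nontriviality of \<open>x^(2^n)\<close> alone is enough to exclude proper quotients: it gives
  \<open>x\<close> the full order \<open>2^(n+1)\<close>, and \<open>y\<close> inverts \<open>x\<close>, so \<open>y\<close> cannot be a power of \<open>x\<close>.
  The generators are parameters in order that subgroups can be treated by the same lemmas.
\<close>
locale quaternion_basis = group G for G (structure) +
  fixes x y :: 'a and n :: nat
  assumes n_ge_1: "n \<ge> 1"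
    and x_closed [simp]: "x \<in> carrier G"
    and y_closed [simp]: "y \<in> carrier G"
    and x_pow_eq_1: "x [^] ((2::nat) ^ (n + 1)) = \<one>"
    and x_pow_neq_1: "x [^] ((2::nat) ^ n) \<noteq> \<one>"
    and y_square: "y \<otimes> y = x [^] ((2::nat) ^ n)"
    and y_x: "y \<otimes> x = inv x \<otimes> y"
    and carrier_eq_generate: "carrier G = generate G {x, y}"
begin

text \<open>Integer exponents make the multiplication rules below free of case distinctions.\<close>
definition xp :: "int \<Rightarrow> 'a" where "xp i = x [^] i"
definition xpy :: "int \<Rightarrow> 'a" where "xpy i = xp i \<otimes> y"

lemma xp_closed [simp]: "xp i \<in> carrier G" by (simp add: xp_def)
lemma xpy_closed [simp]: "xpy i \<in> carrier G" by (simp add: xpy_def)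

lemma ord_x: "ord x = 2 ^ (n + 1)"
proof -
  have "ord x dvd 2 ^ (n + 1)" "\<not> ord x dvd 2 ^ n"
    using x_pow_eq_1 x_pow_neq_1 unfolding pow_eq_id[OF x_closed] by this+
  then obtain k where "k \<le> n + 1" "ord x = 2 ^ k"
    using divides_primepow_nat[of 2 "ord x" "n + 1"] two_is_prime_nat by auto
  moreover from this have "\<not> k \<le> n"
    using \<open>\<not> ord x dvd 2 ^ n\<close> le_imp_power_dvd by metis
  ultimately show ?thesis by (metis Suc_eq_plus1 le_SucE)
qed

lemma xp_eq_iff: "xp i = xp j \<longleftrightarrow> 2 ^ (n + 1) dvd i - j"
proof -
  have "xp i = xp j \<longleftrightarrow> int (ord x) dvd i - j"
    unfolding xp_def using int_pow_eq[OF x_closed] by (simp add: dvd_diff_commute)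
  then show ?thesis by (simp add: ord_x)
qed

lemma xp_0: "xp 0 = \<one>" by (simp add: xp_def)

lemma xp_xp: "xp i \<otimes> xp j = xp (i + j)" by (simp add: xp_def int_pow_mult)

lemma xp_pow: "xp i [^] (k::int) = xp (i * k)"
  by (simp add: xp_def int_pow_pow)

lemma y_xp: "y \<otimes> xp i = xp (- i) \<otimes> y"
proof -
  have x: "x = xp 1" and inv_x: "inv x = xp (- 1)"
    by (simp_all add: xp_def int_pow_neg)
  have yx: "y \<otimes> xp 1 = xp (- 1) \<otimes> y"
    using y_x by (simp only: x[symmetric] inv_x[symmetric])
  have "xp 1 \<otimes> (y \<otimes> xp 1) = y"
    unfolding yx by (simp add: m_assoc[symmetric] xp_xp xp_0)
  then have "xp 1 \<otimes> y \<otimes> (xp 1 \<otimes> xp (- 1)) = y \<otimes> xp (- 1)"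
    by (simp add: m_assoc[symmetric])
  then have yx': "y \<otimes> xp (- 1) = xp 1 \<otimes> y"
    by (simp add: xp_xp xp_0)
  show ?thesis
  proof (induction i rule: int_induct[where k = 0])
    case base
    then show ?case by (simp add: xp_0)
  next
    case (step1 i)
    have "y \<otimes> xp (i + 1) = (y \<otimes> xp i) \<otimes> xp 1"
      by (simp add: m_assoc xp_xp)
    also have "\<dots> = xp (- i) \<otimes> (y \<otimes> xp 1)"
      unfolding step1 by (simp add: m_assoc)
    also have "\<dots> = (xp (- i) \<otimes> xp (- 1)) \<otimes> y"
      unfolding yx by (simp add: m_assoc)
    also have "\<dots> = xp (- (i + 1)) \<otimes> y"
      by (simp add: xp_xp)
    finally show ?case .
  next
    case (step2 i)
    have "y \<otimes> xp (i - 1) = (y \<otimes> xp i) \<otimes> xp (- 1)"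
      by (simp add: m_assoc xp_xp)
    also have "\<dots> = xp (- i) \<otimes> (y \<otimes> xp (- 1))"
      unfolding step2 by (simp add: m_assoc)
    also have "\<dots> = (xp (- i) \<otimes> xp 1) \<otimes> y"
      unfolding yx' by (simp add: m_assoc)
    also have "\<dots> = xp (- (i - 1)) \<otimes> y"
      by (simp add: xp_xp)
    finally show ?case .
  qed
qed

lemma xp_xpy: "xp i \<otimes> xpy j = xpy (i + j)"
  by (simp add: xpy_def m_assoc[symmetric] xp_xp)

lemma xpy_xp: "xpy i \<otimes> xp j = xpy (i - j)"
  by (simp add: xpy_def m_assoc y_xp) (simp add: m_assoc[symmetric] xp_xp)

lemma xpy_xpy: "xpy i \<otimes> xpy j = xp (i - j + 2 ^ n)"
proof -
  have "xpy i \<otimes> xpy j = (xpy i \<otimes> xp j) \<otimes> y"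
    by (simp add: xpy_def m_assoc)
  also have "\<dots> = xp (i - j) \<otimes> (y \<otimes> y)"
    unfolding xpy_xp by (simp add: xpy_def m_assoc)
  also have "y \<otimes> y = xp (2 ^ n)"
    unfolding y_square xp_def by (metis int_pow_int of_nat_numeral of_nat_power)
  finally show ?thesis by (simp add: xp_xp)
qed

lemmas mult_simps = xp_xp xp_xpy xpy_xp xpy_xpy

lemma inv_xp: "inv xp i = xp (- i)"
  by (rule inv_equality) (simp_all add: mult_simps xp_0)

lemma inv_xpy: "inv xpy i = xpy (i + 2 ^ n)"
  by (rule inv_equality) (simp_all add: mult_simps xp_eq_iff xp_0[symmetric])

lemma xpy_eq_iff: "xpy i = xpy j \<longleftrightarrow> 2 ^ (n + 1) dvd i - j"
  by (simp add: xpy_def xp_eq_iff)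

lemma dvd_two_power_of_dvd_double: "(2::int) ^ (n + 1) dvd i - j \<Longrightarrow> 2 ^ n dvd i - j"
  by (rule dvd_trans[rotated]) auto

text \<open>
  An element \<open>x^j y\<close> inverts \<open>x\<close>, whereas \<open>x^i\<close> centralizes it; were they equal, \<open>x\<close> would be an
  involution, against \<open>n \<ge> 1\<close>.
\<close>
lemma xp_neq_xpy: "xp i \<noteq> xpy j"
proof
  assume eq: "xp i = xpy j"
  have "xp (i + 1) = xp (i - 1)"
  proof -
    have "xp (i + 1) = xp 1 \<otimes> xpy j" by (simp add: xp_xp add.commute flip: eq)
    also have "\<dots> = xpy j \<otimes> xp (- 1)" by (simp add: mult_simps add.commute)
    also have "\<dots> = xp (i - 1)" by (simp add: xp_xp flip: eq)
    finally show ?thesis .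
  qed
  then have "(2::int) ^ (n + 1) dvd 2" by (simp add: xp_eq_iff)
  then have "(2::int) ^ (n + 1) \<le> 2 ^ 1" by (simp add: zdvd_imp_le)
  then have "n + 1 \<le> 1" by (rule power_le_imp_le_exp[rotated]) simp
  then show False using n_ge_1 by simp
qed

lemmas xpy_neq_xp = xp_neq_xpy[symmetric]

lemma carrier_cases:
  assumes "a \<in> carrier G"
  obtains i where "a = xp i" | i where "a = xpy i"
proof -
  have "a \<in> generate G {x, y}" using assms carrier_eq_generate by simp
  then have "a \<in> range xp \<union> range xpy"
  proof (induction rule: generate.induct)
    case one
    then show ?case using xp_0 by (metis UnI1 rangeI)
  next
    case (incl h)
    have "x = xp 1" "y = xpy 0" by (simp_all add: xpy_def xp_def)
    with incl show ?case by blast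
  next
    case (inv h)
    have "x = xp 1" "y = xpy 0" by (simp_all add: xpy_def xp_def)
    with inv show ?case by (metis UnI1 UnI2 insertE inv_xp inv_xpy rangeI singletonD)
  next
    case (eng a b)
    then show ?case by (auto simp: mult_simps)
  qed
  then show thesis using that by blast
qed

section \<open>The cyclic subgroups of a generalized quaternion group\<close>

lemma xp_mem_generate_xp:
  assumes "k \<le> n + 1"
  shows "xp i \<in> generate G {xp (2 ^ k)} \<longleftrightarrow> 2 ^ k dvd i"
proof
  assume "xp i \<in> generate G {xp (2 ^ k)}"
  then obtain t where "xp i = xp (2 ^ k * t)"
    using generate_pow[of "xp (2 ^ k)"] by (auto simp: xp_pow)
  moreover have "(2::int) ^ k dvd 2 ^ (n + 1)"
    using assms by (rule le_imp_power_dvd)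
  ultimately have "(2::int) ^ k dvd i - 2 ^ k * t"
    unfolding xp_eq_iff using dvd_trans by blast
  then show "2 ^ k dvd i" by (metis dvd_diffD dvd_triv_left dvd_diff_right_iff dvd_diff_left_iff)
next
  assume "2 ^ k dvd i"
  then obtain t where "i = 2 ^ k * t" by auto
  then show "xp i \<in> generate G {xp (2 ^ k)}"
    using generate_pow[of "xp (2 ^ k)"] by (auto simp: xp_pow)
qed

lemma xpy_notin_generate_xp: "xpy i \<notin> generate G {xp j}"
  using generate_pow[of "xp j"] by (auto simp: xp_pow xpy_neq_xp)

text \<open>
  The exponent \<open>2^k\<close> is the greatest common divisor of \<open>i\<close> and the order of \<open>x\<close>; Bezout's
  identity expresses \<open>x^(2^k)\<close> as a power of \<open>x^i\<close>.
\<close>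
lemma generate_xp_normal_form:
  obtains k where "k \<le> n + 1" "2 ^ k dvd i" "generate G {xp i} = generate G {xp (2 ^ k)}"
proof -
  define g where "g = gcd i (2 ^ (n + 1))"
  have "g dvd 2 ^ (n + 1)" "g \<ge> 0" unfolding g_def by auto
  then have "nat g dvd 2 ^ (n + 1)"
    by (metis nat_dvd_iff nat_numeral nat_power_eq zero_le_numeral int_dvd_int_iff of_nat_numeral of_nat_power nat_0_le)
  then obtain k where k: "k \<le> n + 1" "nat g = 2 ^ k"
    using divides_primepow_nat[of 2 "nat g" "n + 1"] two_is_prime_nat by auto
  then have g: "g = 2 ^ k" using \<open>g \<ge> 0\<close>
    by (metis nat_0_le of_nat_numeral of_nat_power)
  then have dvd: "2 ^ k dvd i" unfolding g_def by (metis gcd_dvd1)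
  obtain u v where "u * i + v * 2 ^ (n + 1) = g"
    unfolding g_def using bezout_int by blast
  then have "xp (2 ^ k) = xp (i * u)"
    unfolding xp_eq_iff g by (metis add_diff_cancel_left' dvd_triv_right mult.commute)
  then have "xp (2 ^ k) \<in> generate G {xp i}"
    using generate_pow[of "xp i"] by (auto simp: xp_pow)
  moreover have "xp i \<in> generate G {xp (2 ^ k)}"
    using xp_mem_generate_xp k dvd by simp
  ultimately have "generate G {xp i} = generate G {xp (2 ^ k)}"
    by (intro equalityI generate_subgroup_incl generate_is_subgroup) auto
  then show thesis using that k dvd by blast
qed

text \<open>
  The right-hand side has just four elements, since exponents count modulo \<open>2^(n+1)\<close>. Describing
  it by divisibility by \<open>2^n\<close> turns questions about these subgroups into congruences.
\<close>
lemma generate_xpy: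
  "generate G {xpy i} = xp ` {k. 2 ^ n dvd k} \<union> xpy ` {k. 2 ^ n dvd k - i}"
    (is "_ = ?S")
proof
  have "subgroup ?S G"
  proof (rule subgroupI)
    show "?S \<noteq> {}" by auto
    show "inv a \<in> ?S" if "a \<in> ?S" for a
      using that by (auto simp: inv_xp inv_xpy algebra_simps intro!: imageI)
    show "a \<otimes> b \<in> ?S" if "a \<in> ?S" "b \<in> ?S" for a b
    proof -
      have *: "(2::int) ^ n dvd k - l" if "2 ^ n dvd k - i" "2 ^ n dvd l - i" for k l
        using dvd_diff[OF that] by simp
      have "(2::int) ^ n dvd k + l - i" "(2::int) ^ n dvd l - k - i"
        if "2 ^ n dvd k" "2 ^ n dvd l - i" for k l
        using dvd_add[OF that] dvd_diff[OF that(2,1)] by (simp_all add: algebra_simps)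
      with * show ?thesis using that by (auto simp: mult_simps intro!: imageI)
    qed
  qed auto
  then show "generate G {xpy i} \<subseteq> ?S"
    by (intro generate_subgroup_incl) auto
  have sub: "subgroup (generate G {xpy i}) G"
    by (rule generate_is_subgroup) simp
  have xpy: "xpy i \<in> generate G {xpy i}" by (simp add: generate.incl)
  have xp: "xp k \<in> generate G {xpy i}" if "2 ^ n dvd k" for k
  proof -
    from that obtain t where t: "k = 2 ^ n * t" by (rule dvdE)
    have "xp (2 ^ n) \<in> generate G {xpy i}"
      using subgroup.m_closed[OF sub xpy xpy] by (simp add: xpy_xpy)
    then have "xp (2 ^ n) [^] t \<in> generate G {xpy i}"
      by (rule subgroup_int_pow_closed[OF sub])
    then show ?thesis by (simp add: xp_pow t)
  qed
  have "xpy k \<in> generate G {xpy i}" if "2 ^ n dvd k - i" for k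
    using subgroup.m_closed[OF sub xp[OF that] xpy] by (simp add: xp_xpy)
  then show "?S \<subseteq> generate G {xpy i}" using xp by auto
qed

lemma xp_mem_generate_xpy: "xp k \<in> generate G {xpy i} \<longleftrightarrow> 2 ^ n dvd k"
proof -
  have "(2::int) ^ n dvd k" if "xp k = xp l" "2 ^ n dvd l" for l
    using that dvd_two_power_of_dvd_double[of k l] by (simp add: xp_eq_iff) (metis diff_add_cancel dvd_add)
  then show ?thesis unfolding generate_xpy by (auto simp: xp_neq_xpy)
qed

lemma xpy_mem_generate_xpy: "xpy k \<in> generate G {xpy i} \<longleftrightarrow> 2 ^ n dvd k - i"
proof -
  have "(2::int) ^ n dvd k - i" if "xpy k = xpy l" "2 ^ n dvd l - i" for l
    using dvd_add[OF dvd_two_power_of_dvd_double[of k l] that(2)] that(1) by (simp add: xpy_eq_iff)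
  then show ?thesis unfolding generate_xpy by (auto simp: xpy_neq_xp)
qed


definition cyclic_x :: "nat \<Rightarrow> 'a set" where "cyclic_x k = generate G {xp (2 ^ k)}"
definition cyclic_xy :: "nat \<Rightarrow> 'a set" where "cyclic_xy i = generate G {xpy (int i)}"

lemma inj_on_cyclic_x: "inj_on cyclic_x {..n + 1}"
proof (rule inj_onI)
  fix k l assume kl: "k \<in> {..n + 1}" "l \<in> {..n + 1}" and "cyclic_x k = cyclic_x l"
  then have "xp i \<in> cyclic_x k \<longleftrightarrow> xp i \<in> cyclic_x l" for i by simp
  then have *: "(2::int) ^ k dvd i \<longleftrightarrow> 2 ^ l dvd i" for i
    using kl by (simp add: cyclic_x_def xp_mem_generate_xp)
  have "(2::int) ^ k dvd 2 ^ l" "(2::int) ^ l dvd 2 ^ k"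
    by (rule iffD2[OF * dvd_refl], rule iffD1[OF * dvd_refl])
  then have "(2::int) ^ k = 2 ^ l" by (intro zdvd_antisym_nonneg) simp_all
  then show "k = l" by simp
qed

lemma inj_on_cyclic_xy: "inj_on cyclic_xy {..<2 ^ n}"
proof (rule inj_onI)
  fix i j assume ij: "i \<in> {..<2 ^ n}" "j \<in> {..<2 ^ n}" and "cyclic_xy i = cyclic_xy j"
  then have "xpy (int i) \<in> cyclic_xy j"
    by (metis cyclic_xy_def generate.incl singletonI)
  then have "int i mod 2 ^ n = int j mod 2 ^ n"
    by (simp add: cyclic_xy_def xpy_mem_generate_xpy mod_eq_dvd_iff)
  then have "int (i mod 2 ^ n) = int (j mod 2 ^ n)"
    by (simp only: zmod_int of_nat_power of_nat_numeral)
  with ij show "i = j" by simp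
qed

lemma cyclic_x_neq_cyclic_xy: "cyclic_x k \<noteq> cyclic_xy i"
proof -
  have "xpy (int i) \<in> cyclic_xy i" by (simp add: cyclic_xy_def generate.incl)
  moreover have "xpy (int i) \<notin> cyclic_x k" by (simp add: cyclic_x_def xpy_notin_generate_xp)
  ultimately show ?thesis by metis
qed

lemma generate_xpy_normal_form: "generate G {xpy i} = cyclic_xy (nat (i mod 2 ^ n))"
proof -
  have "(2::int) ^ n dvd i - i mod 2 ^ n" by simp
  then have "xpy i \<in> cyclic_xy (nat (i mod 2 ^ n))"
    "xpy (int (nat (i mod 2 ^ n))) \<in> generate G {xpy i}"
    by (simp_all add: cyclic_xy_def xpy_mem_generate_xpy dvd_diff_commute)
  then show ?thesis
    unfolding cyclic_xy_def
    by (intro equalityI generate_subgroup_incl generate_is_subgroup) auto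
qed

lemma cyclic_subgroups_of_split:
  "cyclic_subgroups_of G = cyclic_x ` {..n + 1} \<union> cyclic_xy ` {..<2 ^ n}"
proof (intro equalityI subsetI)
  fix H assume "H \<in> cyclic_subgroups_of G"
  then obtain a where a: "a \<in> carrier G" "H = generate G {a}"
    by (auto simp: cyclic_subgroups_of_eq)
  from a(1) show "H \<in> cyclic_x ` {..n + 1} \<union> cyclic_xy ` {..<2 ^ n}"
  proof (cases rule: carrier_cases)
    case (1 i)
    obtain k where "k \<le> n + 1" "generate G {xp i} = generate G {xp (2 ^ k)}"
      by (rule generate_xp_normal_form)
    then show ?thesis using a 1 by (auto simp: cyclic_x_def)
  next
    case (2 i)
    have "nat (i mod 2 ^ n) < 2 ^ n" by (simp add: nat_less_iff)
    then show ?thesis using a 2 generate_xpy_normal_form[of i] by auto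
  qed
qed (auto simp: cyclic_subgroups_of_eq cyclic_x_def cyclic_xy_def)

section \<open>Which cyclic subgroups commute\<close>

text \<open>Conjugation maps \<open>x^j\<close> to itself or to its inverse, so every subgroup of \<open>\<langle>x\<rangle>\<close> is normal.\<close>
lemma cyclic_x_normal:
  assumes "k \<le> n + 1"
  shows "cyclic_x k \<lhd> G"
proof -
  have sub: "subgroup (cyclic_x k) G"
    unfolding cyclic_x_def by (rule generate_is_subgroup) simp
  have "a \<otimes> b \<otimes> inv a \<in> cyclic_x k" if a: "a \<in> carrier G" and b: "b \<in> cyclic_x k" for a b
  proof -
    have "b \<in> carrier G" using b subgroup.subset[OF sub] by auto
    then obtain j where j: "b = xp j"
      using carrier_cases[of b] b xpy_notin_generate_xp by (metis cyclic_x_def)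
    have "2 ^ k dvd j"
      using b assms by (simp add: j cyclic_x_def xp_mem_generate_xp)
    have "a \<otimes> b \<otimes> inv a = xp j \<or> a \<otimes> b \<otimes> inv a = xp (- j)"
      using a
    proof (cases rule: carrier_cases)
      case (1 i)
      then show ?thesis by (simp add: j inv_xp mult_simps)
    next
      case (2 i)
      have "xpy i \<otimes> xp j \<otimes> inv (xpy i) = xp (- j)"
        by (simp add: inv_xpy mult_simps)
      then show ?thesis by (simp add: 2 j)
    qed
    then show ?thesis
      using \<open>2 ^ k dvd j\<close> assms by (auto simp: cyclic_x_def xp_mem_generate_xp)
  qed
  then show ?thesis using sub normal_inv_iff by blast
qed

lemma cyclic_x_commutes:
  assumes "k \<le> n + 1" "B \<in> cyclic_subgroups_of G"
  shows "cyclic_x k <#> B = B <#> cyclic_x k"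
  using commut_normal[OF _ cyclic_x_normal[OF assms(1)], of B] assms(2)
  by (simp add: cyclic_subgroups_of_def)

lemma mem_generate_xpy_cases:
  assumes "a \<in> generate G {xpy i}"
  obtains k where "a = xp k" "2 ^ n dvd k" | k where "a = xpy k" "2 ^ n dvd k - i"
  using assms unfolding generate_xpy by auto

text \<open>
  If the products agree, the element \<open>(x^i y) (x^j y) = x^(i-j+2^n)\<close> of the first lies in the
  second, whose elements in \<open>\<langle>x\<rangle>\<close> have exponents congruent to \<open>0\<close> or \<open>j - i\<close> modulo \<open>2^n\<close>; either
  case gives the divisibility. Conversely the divisibility says \<open>i - j \<equiv> j - i\<close> modulo \<open>2^n\<close>,
  which allows the factors of each product to be exchanged.
\<close>
lemma generate_xpy_commute_iff:
  "generate G {xpy i} <#> generate G {xpy j} = generate G {xpy j} <#> generate G {xpy i}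
    \<longleftrightarrow> 2 ^ n dvd 2 * (i - j)"
proof
  let ?A = "\<lambda>i. generate G {xpy i}"
  assume eq: "?A i <#> ?A j = ?A j <#> ?A i"
  have "xpy i \<otimes> xpy j \<in> ?A i <#> ?A j"
    unfolding set_mult_def by (blast intro: generate.incl)
  then have "xp (i - j + 2 ^ n) \<in> ?A j <#> ?A i"
    using eq by (simp add: xpy_xpy)
  then obtain a b where ab: "a \<in> ?A j" "b \<in> ?A i" "a \<otimes> b = xp (i - j + 2 ^ n)"
    unfolding set_mult_def by auto
  from ab(1) show "2 ^ n dvd 2 * (i - j)"
  proof (cases rule: mem_generate_xpy_cases)
    case (1 k)
    note k = 1
    from ab(2) show ?thesis
    proof (cases rule: mem_generate_xpy_cases)
      case (1 l)
      then have "(2::int) ^ (n + 1) dvd k + l - (i - j + 2 ^ n)"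
        using ab(3) k by (simp only: xp_xp xp_eq_iff)
      then have "(2::int) ^ n dvd k + l - (i - j + 2 ^ n)"
        by (rule dvd_two_power_of_dvd_double)
      with k 1 show ?thesis
        by (metis dvd_add dvd_add_left_iff dvd_diff_right_iff dvd_mult dvd_refl dvd_diff dvd_diff_left_iff)
    next
      case (2 l)
      then show ?thesis using ab(3) k by (simp add: xp_xpy xpy_neq_xp)
    qed
  next
    case (2 k)
    note k = 2
    from ab(2) show ?thesis
    proof (cases rule: mem_generate_xpy_cases)
      case (1 l)
      then show ?thesis using ab(3) k by (simp add: xpy_xp xpy_neq_xp)
    next
      case (2 l)
      then have "(2::int) ^ (n + 1) dvd (k - l + 2 ^ n) - (i - j + 2 ^ n)"
        using ab(3) k by (simp only: xpy_xpy xp_eq_iff)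
      then have *: "(2::int) ^ n dvd (k - l + 2 ^ n) - (i - j + 2 ^ n)"
        by (rule dvd_two_power_of_dvd_double)
      have "2 * (i - j) = (k - j) - (l - i) - ((k - l + 2 ^ n) - (i - j + 2 ^ n))"
        by simp
      then show ?thesis using * k(2) 2(2) by (simp only: dvd_diff)
    qed
  qed
next
  have subset: "generate G {xpy i} <#> generate G {xpy j} \<subseteq> generate G {xpy j} <#> generate G {xpy i}"
    if ij: "2 ^ n dvd 2 * (i - j)" for i j
  proof
    let ?A = "\<lambda>i. generate G {xpy i}"
    have mult: "c \<in> ?A j <#> ?A i" if "a \<in> ?A j" "b \<in> ?A i" "c = a \<otimes> b" for a b c
      using that unfolding set_mult_def by auto
    fix c assume "c \<in> ?A i <#> ?A j"
    then obtain a b where ab: "a \<in> ?A i" "b \<in> ?A j" "c = a \<otimes> b"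
      unfolding set_mult_def by auto
    note mem = xp_mem_generate_xpy xpy_mem_generate_xpy
    from ab(1) show "c \<in> ?A j <#> ?A i"
    proof (cases rule: mem_generate_xpy_cases)
      case (1 k)
      note k = 1
      from ab(2) show ?thesis
      proof (cases rule: mem_generate_xpy_cases)
        case (1 l)
        then show ?thesis
          using k ab(3) by (intro mult[of "xp k" "xp l"]) (simp_all add: mem)
      next
        case (2 l)
        have "(2::int) ^ n dvd (k + l) - j"
          using dvd_add[OF k(2) 2(2)] by (simp add: algebra_simps)
        then show ?thesis
          using k 2 ab(3) by (intro mult[of "xpy (k + l)" "xp 0"]) (simp_all add: mem mult_simps)
      qed
    next
      case (2 k)
      note k = 2
      from ab(2) show ?thesis
      proof (cases rule: mem_generate_xpy_cases)
        case (1 l)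
        have "(2::int) ^ n dvd (k - l) - i"
          using dvd_diff[OF k(2) 1(2)] by (simp add: algebra_simps)
        then show ?thesis
          using k 1 ab(3) by (intro mult[of "xp 0" "xpy (k - l)"]) (simp_all add: mem mult_simps)
      next
        case (2 l)
        (* The right factor is chosen to be x^i y; the left one is then forced. *)
        have "(k - l + i) - j = (k - i) - (l - j) + 2 * (i - j)" by simp
        then have "(2::int) ^ n dvd (k - l + i) - j"
          using k(2) 2(2) ij by (simp only: dvd_add dvd_diff)
        then show ?thesis
          using k 2 ab(3)
          by (intro mult[of "xpy (k - l + i)" "xpy i"]) (simp_all add: mem mult_simps)
      qed
    qed
  qed
  assume ij: "2 ^ n dvd 2 * (i - j)"
  then have "2 ^ n dvd 2 * (j - i)"
    by (metis dvd_minus_iff minus_diff_eq mult_minus_right)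
  with ij show "generate G {xpy i} <#> generate G {xpy j} = generate G {xpy j} <#> generate G {xpy i}"
    using subset by blast
qed


lemma card_cyclic_x: "card (cyclic_x ` {..n + 1}) = n + 2"
  by (simp only: card_image[OF inj_on_cyclic_x]) simp

lemma card_cyclic_xy: "card (cyclic_xy ` {..<2 ^ n}) = 2 ^ n"
  by (simp add: card_image[OF inj_on_cyclic_xy])

lemma cyclic_x_xy_disjoint: "cyclic_x ` {..n + 1} \<inter> cyclic_xy ` {..<2 ^ n} = {}"
  using cyclic_x_neq_cyclic_xy by blast

lemma card_cyclic_subgroups_of: "card (cyclic_subgroups_of G) = n + 2 + 2 ^ n"
  unfolding cyclic_subgroups_of_split
  by (subst card_Un_disjoint[OF _ _ cyclic_x_xy_disjoint])
    (simp_all only: card_cyclic_x card_cyclic_xy finite_imageI finite_atMost finite_lessThan)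

lemma card_commuting_cyclic_xy:
  "card {(A, B). A \<in> cyclic_xy ` {..<2 ^ n} \<and> B \<in> cyclic_xy ` {..<2 ^ n} \<and> A <#> B = B <#> A}
    = 2 * 2 ^ n" (is "card ?T = _")
proof -
  define h :: nat where "h = 2 ^ (n - 1)"
  have h: "h > 0" "2 * h = 2 ^ n"
    unfolding h_def using n_ge_1 by (simp_all flip: power_Suc)
  let ?I = "{(i, j). i < 2 * h \<and> j < 2 * h \<and> int (2 * h) dvd 2 * (int i - int j)}"
  have int_h: "int (2 * h) = 2 ^ n" unfolding h(2) by simp
  have I: "(i, j) \<in> ?I \<longleftrightarrow> i < 2 ^ n \<and> j < 2 ^ n
      \<and> cyclic_xy i <#> cyclic_xy j = cyclic_xy j <#> cyclic_xy i" for i j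
    unfolding int_h cyclic_xy_def generate_xpy_commute_iff by (simp add: h(2))
  have "?T = map_prod cyclic_xy cyclic_xy ` ?I"
  proof (intro equalityI subsetI)
    fix p assume "p \<in> ?T"
    then obtain i j where "i < 2 ^ n" "j < 2 ^ n" and p: "p = (cyclic_xy i, cyclic_xy j)"
        and "cyclic_xy i <#> cyclic_xy j = cyclic_xy j <#> cyclic_xy i"
      by auto
    then have "(i, j) \<in> ?I" by (simp only: I simp_thms)
    then show "p \<in> map_prod cyclic_xy cyclic_xy ` ?I" using p by (intro image_eqI[of _ _ "(i, j)"]) (simp only: map_prod_simp)
  next
    fix p assume "p \<in> map_prod cyclic_xy cyclic_xy ` ?I"
    then obtain i j where "(i, j) \<in> ?I" "p = (cyclic_xy i, cyclic_xy j)" by blast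
    then show "p \<in> ?T" unfolding I by simp
  qed
  moreover have "inj_on (map_prod cyclic_xy cyclic_xy) ?I"
    by (rule inj_on_subset[OF map_prod_inj_on[OF inj_on_cyclic_xy inj_on_cyclic_xy]])
      (auto simp: h(2))
  ultimately have "card ?T = card ?I" by (simp only: card_image)
  also have "\<dots> = 2 * 2 ^ n" unfolding card_pairs_congruent_mod_half[OF h(1)] using h(2) by simp
  finally show ?thesis .
qed

text \<open>
  Only pairs of subgroups of the form \<open>\<langle>x^i y\<rangle>\<close> can fail to commute, so the count splits into the
  pairs with a component in \<open>\<langle>x\<rangle>\<close> and the commuting pairs just counted.
\<close>
lemma csd_eq: "csd G = csd_quaternion n"
proof -
  let ?C = "cyclic_subgroups_of G"
  let ?P = "cyclic_x ` {..n + 1}" and ?Q = "cyclic_xy ` {..<2 ^ n}"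
  let ?T = "{(A, B). A \<in> ?Q \<and> B \<in> ?Q \<and> A <#> B = B <#> A}"
  have C: "?C = ?P \<union> ?Q" by (rule cyclic_subgroups_of_split)
  have comm: "A <#> B = B <#> A" if "A \<in> ?P" "B \<in> ?C" for A B
    using that cyclic_x_commutes by auto
  have "{(A, B). A \<in> ?C \<and> B \<in> ?C \<and> A <#> B = B <#> A} = (?P \<times> ?C \<union> ?Q \<times> ?P) \<union> ?T"
    using comm comm[symmetric] C by auto
  moreover have "card ((?P \<times> ?C \<union> ?Q \<times> ?P) \<union> ?T) = card (?P \<times> ?C \<union> ?Q \<times> ?P) + card ?T"
  proof (rule card_Un_disjoint)
    have "?T \<subseteq> ?Q \<times> ?Q" by auto
    then show "finite ?T" by (rule finite_subset) auto
    show "(?P \<times> ?C \<union> ?Q \<times> ?P) \<inter> ?T = {}" using cyclic_x_xy_disjoint by auto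
  qed (simp add: C)
  moreover have "card (?P \<times> ?C \<union> ?Q \<times> ?P) = card (?P \<times> ?C) + card (?Q \<times> ?P)"
    by (rule card_Un_disjoint) (use C cyclic_x_xy_disjoint in auto)
  ultimately have card: "card {(A, B). A \<in> ?C \<and> B \<in> ?C \<and> A <#> B = B <#> A}
      = (n + 2) * (n + 2 + 2 ^ n) + 2 ^ n * (n + 2) + 2 * 2 ^ n"
    by (simp only: card_cartesian_product card_cyclic_x card_cyclic_xy
        card_cyclic_subgroups_of card_commuting_cyclic_xy)
  have *: "(a * (a + N) + N * a + 2 * N) / (a + N)\<^sup>2 = 1 - N * (N - 2) / (a + N)\<^sup>2"
    if "a + N \<noteq> 0" for a N :: real
  proof -
    have "a * (a + N) + N * a + 2 * N = (a + N)\<^sup>2 - N * (N - 2)"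
      by (simp add: power2_eq_square algebra_simps)
    then show ?thesis using that by (simp add: diff_divide_distrib)
  qed
  have "real n + 2 + 2 ^ n \<noteq> 0"
    by (metis add_nonneg_pos add_nonneg_nonneg of_nat_0_le_iff zero_le_numeral zero_less_numeral zero_less_power less_irrefl)
  then show ?thesis
    unfolding csd_def card card_cyclic_subgroups_of csd_quaternion_def
    using *[OF \<open>real n + 2 + 2 ^ n \<noteq> 0\<close>]
    by (simp only: of_nat_add of_nat_mult of_nat_power of_nat_numeral times_divide_eq_left mult_1_left)
qed

section \<open>Subgroups of a generalized quaternion group\<close>

text \<open>
  If \<open>H\<close> contains some \<open>x^i y\<close>, it contains its square \<open>x^(2^n)\<close>, so the intersection of \<open>H\<close> with
  \<open>\<langle>x\<rangle>\<close> is generated by some \<open>x^(2^j)\<close> with \<open>j \<le> n\<close>. Every further element \<open>x^k y\<close> of \<open>H\<close>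
  differs from \<open>x^i y\<close> by an element of that intersection.
\<close>
lemma subgroup_cases:
  assumes H: "subgroup H G"
  obtains "H \<subseteq> generate G {x}"
  | j i where "j \<le> n" "H = generate G {xp (2 ^ j), xpy i}"
proof (cases "\<exists>i. xpy i \<in> H")
  case False
  have "H \<subseteq> generate G {x}"
  proof
    fix a assume a: "a \<in> H"
    then obtain i where "a = xp i"
      using False carrier_cases[of a] subgroup.subset[OF H] by blast
    then show "a \<in> generate G {x}"
      unfolding xp_def generate_pow[OF x_closed] by auto
  qed
  then show ?thesis using that(1) by blast
next
  case True
  then obtain i where i: "xpy i \<in> H" by blast
  have mem_mult: "a \<otimes> b \<in> H" if "a \<in> H" "b \<in> H" for a b
    using subgroup.m_closed[OF H that] .
  have z: "xp (2 ^ n) \<in> H" using mem_mult[OF i i] by (simp add: xpy_xpy)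
  define j where "j = (LEAST j. xp (2 ^ j) \<in> H)"
  have j: "j \<le> n" "xp (2 ^ j) \<in> H"
    unfolding j_def using z by (auto intro: Least_le LeastI)
  have dvd: "2 ^ j dvd k" if k: "xp k \<in> H" for k
  proof -
    obtain l where l: "2 ^ l dvd k" "generate G {xp k} = generate G {xp (2 ^ l)}"
      using generate_xp_normal_form[of k] by blast
    have "xp (2 ^ l) \<in> generate G {xp k}" unfolding l(2) by (simp add: generate.incl)
    moreover have "generate G {xp k} \<subseteq> H" using k H by (intro generate_subgroup_incl) auto
    ultimately have "j \<le> l" unfolding j_def by (intro Least_le) auto
    then show ?thesis using l(1) le_imp_power_dvd dvd_trans by blast
  qed
  let ?K = "generate G {xp (2 ^ j), xpy i}"
  have K: "subgroup ?K G" by (rule generate_is_subgroup) simp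
  have xp_K: "xp k \<in> ?K" if "xp k \<in> H" for k
  proof -
    from dvd[OF that] obtain t where t: "k = 2 ^ j * t" by (rule dvdE)
    have "xp (2 ^ j) [^] t \<in> ?K"
      by (rule subgroup_int_pow_closed[OF K]) (simp add: generate.incl)
    then show ?thesis by (simp add: t xp_pow)
  qed
  have xpy_K: "xpy k \<in> ?K" if "xpy k \<in> H" for k
  proof -
    (* The product of x^k y and x^i y is x^(k-i) up to the central factor x^(2^n), removed next. *)
    have "xp (k - i + 2 ^ n) \<in> H" using mem_mult[OF that i] by (simp add: xpy_xpy)
    then have "xp (k - i + 2 ^ n) \<otimes> xp (2 ^ n) \<in> H" using z mem_mult by blast
    then have "xp (k - i + 2 ^ n + 2 ^ n) \<in> ?K" by (intro xp_K) (simp add: xp_xp)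
    moreover have "xp (k - i + 2 ^ n + 2 ^ n) = xp (k - i)" by (simp add: xp_eq_iff)
    ultimately have "xp (k - i) \<in> ?K" by simp
    moreover have "xpy i \<in> ?K" by (simp add: generate.incl)
    ultimately have "xp (k - i) \<otimes> xpy i \<in> ?K" using subgroup.m_closed[OF K] by blast
    then show ?thesis by (simp add: xp_xpy)
  qed
  have "H \<subseteq> ?K"
  proof
    fix a assume a: "a \<in> H"
    then have "a \<in> carrier G" using subgroup.subset[OF H] by blast
    then show "a \<in> ?K" using a xp_K xpy_K by (cases rule: carrier_cases) auto
  qed
  moreover have "?K \<subseteq> H" using i j H by (intro generate_subgroup_incl) auto
  ultimately show ?thesis using that(2) j(1) by blast
qed

text \<open>
  The square of \<open>x^i y\<close> is \<open>x^(2^n)\<close>, which is also the power of \<open>x^(2^j)\<close> with exponent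
  \<open>2^(n-j)\<close>; so the relations are inherited with \<open>n - j\<close> in place of \<open>n\<close>. For \<open>j = n\<close> the subgroup
  is cyclic of order four.
\<close>
lemma quaternion_basis_subgroup:
  fixes i :: int
  assumes "j < n"
  defines "K \<equiv> generate G {xp (2 ^ j), xpy i}"
  shows "quaternion_basis (G\<lparr>carrier := K\<rparr>) (xp (2 ^ j)) (xpy i) (n - j)"
proof -
  have sub: "subgroup K G" unfolding K_def by (rule generate_is_subgroup) simp
  interpret K: group "G\<lparr>carrier := K\<rparr>" by (rule subgroup_imp_group[OF sub])
  have mem: "xp (2 ^ j) \<in> K" "xpy i \<in> K" by (simp_all add: K_def generate.incl)
  have pow: "xp (2 ^ j) [^]\<^bsub>G\<lparr>carrier := K\<rparr>\<^esub> ((2::nat) ^ m) = xp (2 ^ (j + m))" for m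
  proof -
    have "xp (2 ^ j) [^] ((2::nat) ^ m) = xp (2 ^ j) [^] int ((2::nat) ^ m)"
      by (simp only: int_pow_int)
    also have "\<dots> = xp (2 ^ (j + m))" by (simp add: xp_pow power_add)
    finally show ?thesis by (simp add: nat_pow_consistent[symmetric])
  qed
  show ?thesis
  proof (unfold_locales, unfold pow)
    show "n - j \<ge> 1" using assms by simp
    have "j + (n - j + 1) = n + 1" "j + (n - j) = n" using assms by simp_all
    then show "xp (2 ^ (j + (n - j + 1))) = \<one>\<^bsub>G\<lparr>carrier := K\<rparr>\<^esub>"
      and "xp (2 ^ (j + (n - j))) \<noteq> \<one>\<^bsub>G\<lparr>carrier := K\<rparr>\<^esub>"
      and "xpy i \<otimes>\<^bsub>G\<lparr>carrier := K\<rparr>\<^esub> xpy i = xp (2 ^ (j + (n - j)))"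
      by (simp_all add: xp_0[symmetric] xp_eq_iff xpy_xpy) 
    show "xpy i \<otimes>\<^bsub>G\<lparr>carrier := K\<rparr>\<^esub> xp (2 ^ j)
        = inv\<^bsub>G\<lparr>carrier := K\<rparr>\<^esub> xp (2 ^ j) \<otimes>\<^bsub>G\<lparr>carrier := K\<rparr>\<^esub> xpy i"
      using m_inv_consistent[OF sub mem(1)] by (simp add: inv_xp mult_simps)
    have "generate (G\<lparr>carrier := K\<rparr>) {xp (2 ^ j), xpy i} = K"
      using generate_consistent[OF _ sub, of "{xp (2 ^ j), xpy i}"] mem K_def by auto
    then show "carrier (G\<lparr>carrier := K\<rparr>) = generate (G\<lparr>carrier := K\<rparr>) {xp (2 ^ j), xpy i}"
      by simp
  qed (simp_all add: mem)
qed

lemma g1_generate: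
  assumes "j < n"
  shows "g1 G (generate G {xp (2 ^ j), xpy i}) = csd_quaternion (n - j)"
  unfolding g1_def by (rule quaternion_basis.csd_eq[OF quaternion_basis_subgroup[OF assms]])

text \<open>
  The degree 1 of the subgroups of cyclic groups adds no value, as it is already attained by the
  quaternion group of order eight.
\<close>
lemma g1_image:
  assumes fin: "finite (carrier G)"
  shows "g1 G ` subgroups_of G = csd_quaternion ` {1..n}"
proof (intro equalityI subsetI)
  have one: "1 \<in> csd_quaternion ` {1..n}"
    using n_ge_1 by (intro image_eqI[of _ _ 1]) (simp_all add: csd_quaternion_def)
  fix v assume "v \<in> g1 G ` subgroups_of G"
  then obtain H where H: "subgroup H G" and v: "v = g1 G H"
    by (auto simp: subgroups_of_def)
  from H show "v \<in> csd_quaternion ` {1..n}"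
  proof (cases rule: subgroup_cases)
    case 1
    then show ?thesis using g1_subgroup_of_cyclic[OF fin H x_closed] one v by simp
  next
    case (2 j i)
    show ?thesis
    proof (cases "j = n")
      case True
      have "{xp (2 ^ n), xpy i} \<subseteq> generate G {xpy i}"
        by (simp add: xp_mem_generate_xpy generate.incl)
      then have "H \<subseteq> generate G {xpy i}"
        unfolding 2(2) True by (rule generate_subgroup_incl) (simp add: generate_is_subgroup)
      then show ?thesis using g1_subgroup_of_cyclic[OF fin H xpy_closed] one v by simp
    next
      case False
      then have "j < n" using 2(1) by simp
      then show ?thesis unfolding v 2(2) by (subst g1_generate) auto
    qed
  qed
next
  fix v assume "v \<in> csd_quaternion ` {1..n}"
  then obtain k where k: "1 \<le> k" "k \<le> n" "v = csd_quaternion k" by auto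
  let ?K = "generate G {xp (2 ^ (n - k)), xpy 0}"
  have "v = g1 G ?K" using g1_generate[of "n - k" 0] k by simp
  moreover have "subgroup ?K G" by (rule generate_is_subgroup) simp
  ultimately show "v \<in> g1 G ` subgroups_of G" by (auto simp: subgroups_of_def)
qed

end

lemma quaternion_basis_iso:
  assumes "quaternion_basis P x y n" "h \<in> iso P G" "group G"
  shows "quaternion_basis G (h x) (h y) n"
proof -
  interpret P: quaternion_basis P x y n by fact
  interpret G: group G by fact
  interpret h: group_hom P G h
    using assms(2) by unfold_locales (simp add: iso_def)
  have inj: "inj_on h (carrier P)" and surj: "h ` carrier P = carrier G"
    using assms(2) by (auto simp: iso_def bij_betw_def)
  show ?thesis
  proof unfold_locales
    show "h x [^]\<^bsub>G\<^esub> ((2::nat) ^ (n + 1)) = \<one>\<^bsub>G\<^esub>"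
      using P.x_pow_eq_1 h.hom_nat_pow[OF P.x_closed] h.hom_one by metis
    show "h x [^]\<^bsub>G\<^esub> ((2::nat) ^ n) \<noteq> \<one>\<^bsub>G\<^esub>"
      using P.x_pow_neq_1 h.hom_nat_pow[OF P.x_closed] h.hom_one inj_onD[OF inj]
        P.nat_pow_closed[OF P.x_closed] P.one_closed by metis
    show "h y \<otimes>\<^bsub>G\<^esub> h y = h x [^]\<^bsub>G\<^esub> ((2::nat) ^ n)"
      using P.y_square h.hom_nat_pow[OF P.x_closed] h.hom_mult P.y_closed by metis
    show "h y \<otimes>\<^bsub>G\<^esub> h x = inv\<^bsub>G\<^esub> h x \<otimes>\<^bsub>G\<^esub> h y"
      using P.y_x h.hom_mult h.hom_inv P.y_closed P.x_closed P.inv_closed by metis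
    have "generate G (h ` {x, y}) = h ` generate P {x, y}"
      using h.generate_img[of "{x, y}"] P.x_closed P.y_closed by blast
    then show "carrier G = generate G {h x, h y}"
      using P.carrier_eq_generate surj by simp
  qed (use P.n_ge_1 in simp_all)
qed

section \<open>The presented group\<close>

text \<open>
  The two-dimensional representation of the group, written as an action of the letters on pairs.
  With inverse letters acting by inverse maps, words equal in the presented group act
  equally as soon as the two sides of every relation do (\<open>word_act_eq\<close>).
\<close>
definition letter_act :: "complex \<Rightarrow> quat_gen \<times> bool \<Rightarrow> complex \<times> complex \<Rightarrow> complex \<times> complex"
  where "letter_act w l p = (case l of
      (GenX, True) \<Rightarrow> (w * fst p, inverse w * snd p)
    | (GenX, False) \<Rightarrow> (inverse w * fst p, w * snd p)
    | (GenY, True) \<Rightarrow> (- snd p, fst p)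
    | (GenY, False) \<Rightarrow> (snd p, - fst p))"

definition word_act :: "complex \<Rightarrow> quat_gen gword \<Rightarrow> complex \<times> complex \<Rightarrow> complex \<times> complex"
  where "word_act w u = foldr (letter_act w) u"

lemma word_act_append: "word_act w (u @ v) = word_act w u \<circ> word_act w v"
  by (simp add: word_act_def fun_eq_iff)

lemma word_act_pow_x: "word_act w (wpow wx k) p = (w ^ k * fst p, inverse w ^ k * snd p)"
  by (induction k) (simp_all add: word_act_def letter_act_def)

lemma word_act_eq:
  assumes "word_eq R u v" and "w \<noteq> 0"
    and "\<And>u v. (u, v) \<in> R \<Longrightarrow> word_act w u = word_act w v"
  shows "word_act w u = word_act w v"
  using assms(1)
proof (induction rule: word_eq.induct)
  case (append u u' v v')
  then show ?case by (simp add: word_act_append)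
next
  case (cancel g b)
  show ?case
    using assms(2) by (cases g; cases b) (simp_all add: fun_eq_iff word_act_def letter_act_def)
next
  case (rel u v)
  then show ?case by (rule assms(3))
qed simp_all

lemma pow_presented_group:
  "word_class R u [^]\<^bsub>presented_group R\<^esub> (k::nat) = word_class R (wpow u k)"
proof (induction k)
  case (Suc k)
  have "wpow u k @ u = wpow u (Suc k)" by (induction k) simp_all
  with Suc show ?case by (simp add: mult_presented_group)
qed (simp add: one_presented_group)

text \<open>
  Every condition but the nontriviality of \<open>x^(2^n)\<close> is a consequence of the relations. For
  that one, all four relations are checked in the action on pairs of complex numbers.
\<close>
lemma quaternion_basis_gen_quaternion:
  assumes "n \<ge> 1"
  obtains x y where "quaternion_basis (gen_quaternion (n + 2)) x y n"
proof -
  define R where "R =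
    {(wpow wx (2 ^ (n + 1)), []),
     (wpow wy 4, []),
     (wpow wx (2 ^ n), wpow wy 2),
     (wy @ wx @ wy_inv, wpow wx (2 ^ (n + 1) - 1))}"
  let ?P = "presented_group R"
  have P: "gen_quaternion (n + 2) = ?P" by (simp add: gen_quaternion_def R_def)
  interpret P: group ?P by (rule group_presented_group)
  define x where "x = word_class R wx"
  define y where "y = word_class R wy"
  have closed: "word_class R u \<in> carrier ?P" for u by (simp add: carrier_presented_group)
  have rel: "word_class R u = word_class R v" if "(u, v) \<in> R" for u v
    using that by (simp add: word_class_eq_iff word_eq.rel)
  have pow_x: "x [^]\<^bsub>?P\<^esub> (k::nat) = word_class R (wpow wx k)" for k
    unfolding x_def by (rule pow_presented_group)
  have inv: "inv\<^bsub>?P\<^esub> word_class R [(g, b)] = word_class R [(g, \<not> b)]" for g b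
    using word_eq.cancel[of R g "\<not> b"]
    by (intro P.inv_equality closed)
      (simp add: mult_presented_group one_presented_group word_class_eq_iff)
  have x_order: "x [^]\<^bsub>?P\<^esub> ((2::nat) ^ (n + 1)) = \<one>\<^bsub>?P\<^esub>"
    unfolding pow_x one_presented_group by (rule rel) (simp add: R_def)
  have x_neq: "x [^]\<^bsub>?P\<^esub> ((2::nat) ^ n) \<noteq> \<one>\<^bsub>?P\<^esub>"
  proof
    assume "x [^]\<^bsub>?P\<^esub> ((2::nat) ^ n) = \<one>\<^bsub>?P\<^esub>"
    then have word: "word_eq R (wpow wx (2 ^ n)) []"
      unfolding pow_x one_presented_group word_class_eq_iff .
    (* With this w, both defining powers of x act as required and x^(2^n) acts as -1. *)
    define w where "w = cis (pi / 2 ^ n)"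
    have w: "w \<noteq> 0" "w ^ (2 ^ n) = - 1"
      unfolding w_def by (simp_all add: DeMoivre)
    then have w2: "w ^ (2 ^ (n + 1)) = 1" by (simp add: power_mult mult.commute[of 2])
    have w_inv: "w ^ (2 ^ (n + 1) - 1) = inverse w"
    proof -
      have "w * w ^ (2 ^ (n + 1) - 1) = 1" using w2 by (simp flip: power_Suc)
      then show ?thesis by (metis inverse_unique)
    qed
    have inv_w: "inverse w ^ (2 ^ n) = - 1" "inverse w ^ (2 ^ (n + 1)) = 1"
        "inverse w ^ (2 ^ (n + 1) - 1) = w"
      using w w2 w_inv by (simp_all only: power_inverse) simp_all
    have word_act_simps: "word_act w wy = (\<lambda>p. (- snd p, fst p))"
        "word_act w (wy @ wx @ wy_inv) = (\<lambda>p. (inverse w * fst p, w * snd p))"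
        "word_act w (wpow wy 4) = id" "word_act w (wpow wy 2) = (\<lambda>p. (- fst p, - snd p))"
        "word_act w [] = id"
      by (auto simp: fun_eq_iff word_act_def letter_act_def numeral_eq_Suc)
    have "word_act w u = word_act w v" if "(u, v) \<in> R" for u v
      using that unfolding R_def
      by (elim insertE emptyE Pair_inject; hypsubst; simp only: word_act_simps)
        (simp_all only: fun_eq_iff word_act_pow_x w w2 w_inv inv_w, simp_all)
    then have "word_act w (wpow wx (2 ^ n)) (1, 0) = word_act w [] (1, 0)"
      using word_act_eq[OF word w(1)] by metis
    then show False unfolding word_act_pow_x w by (simp add: word_act_def)
  qed
  have y_sq: "y \<otimes>\<^bsub>?P\<^esub> y = x [^]\<^bsub>?P\<^esub> ((2::nat) ^ n)"
  proof -
    have "word_class R (wpow wx (2 ^ n)) = word_class R (wpow wy 2)"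
      by (rule rel) (simp add: R_def)
    then show ?thesis unfolding pow_x by (simp add: y_def mult_presented_group numeral_2_eq_2)
  qed
  have x_closed: "x \<in> carrier ?P" and y_closed: "y \<in> carrier ?P"
    by (simp_all add: x_def y_def closed)
  have yx: "y \<otimes>\<^bsub>?P\<^esub> x = inv\<^bsub>?P\<^esub> x \<otimes>\<^bsub>?P\<^esub> y"
  proof -
    have "x [^]\<^bsub>?P\<^esub> ((2::nat) ^ (n + 1) - 1) \<otimes>\<^bsub>?P\<^esub> x = \<one>\<^bsub>?P\<^esub>"
      using x_order by (simp flip: P.nat_pow_Suc)
    then have inv_x: "inv\<^bsub>?P\<^esub> x = x [^]\<^bsub>?P\<^esub> ((2::nat) ^ (n + 1) - 1)"
      by (intro P.inv_equality x_closed P.nat_pow_closed)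
    have "word_class R (wy @ wx @ wy_inv) = word_class R (wpow wx (2 ^ (n + 1) - 1))"
      by (rule rel) (simp add: R_def)
    then have "y \<otimes>\<^bsub>?P\<^esub> x \<otimes>\<^bsub>?P\<^esub> inv\<^bsub>?P\<^esub> y = inv\<^bsub>?P\<^esub> x"
      unfolding inv_x pow_x by (simp add: x_def y_def inv mult_presented_group)
    then show ?thesis
      using x_closed y_closed by (metis P.inv_closed P.inv_solve_right' P.m_closed)
  qed
  have gen: "carrier ?P = generate ?P {x, y}"
  proof
    have letter: "word_class R [(g, b)] \<in> generate ?P {x, y}" for g b
    proof (cases b)
      case True
      then show ?thesis by (cases g) (simp_all add: x_def y_def generate.incl)
    next
      case False
      have "inv\<^bsub>?P\<^esub> word_class R [(g, True)] \<in> generate ?P {x, y}"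
        by (cases g) (simp_all only: x_def y_def generate.inv insert_iff simp_thms)
      then show ?thesis using False by (simp add: inv)
    qed
    have "word_class R u \<in> generate ?P {x, y}" for u
    proof (induction u)
      case Nil
      then show ?case using generate.one[of ?P] by (simp add: one_presented_group)
    next
      case (Cons l u)
      obtain g b where "l = (g, b)" by (cases l)
      then show ?case
        using generate.eng[OF letter Cons] by (simp add: mult_presented_group)
    qed
    then show "carrier ?P \<subseteq> generate ?P {x, y}" by (auto simp: carrier_presented_group)
    show "generate ?P {x, y} \<subseteq> carrier ?P"
      using x_closed y_closed by (intro P.generate_incl) simp
  qed
  have "quaternion_basis ?P x y n"
    by unfold_locales (fact assms x_closed y_closed x_order x_neq y_sq yx gen)+
  then show thesis using that P by simp
qed

section \<open>The number of values\<close>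

theorem theorem3p12:
  fixes G :: "('a, 'b) monoid_scheme" and n :: nat
  assumes "n \<ge> 1"
    and "group G"
    and "finite (carrier G)"
    and "G \<cong> gen_quaternion (n + 2)"
  shows "card (g1 G ` subgroups_of G) = n"
proof -
  obtain x y where basis: "quaternion_basis (gen_quaternion (n + 2)) x y n"
    using quaternion_basis_gen_quaternion[OF assms(1)] .
  obtain h where "h \<in> iso (gen_quaternion (n + 2)) G"
    using group.iso_sym[OF assms(2,4)] by (auto simp: is_iso_def)
  then have "quaternion_basis G (h x) (h y) n"
    using assms(2) by (rule quaternion_basis_iso[OF basis])
  then have "g1 G ` subgroups_of G = csd_quaternion ` {1..n}"
    using assms(3) by (rule quaternion_basis.g1_image)
  then show ?thesis
    by (simp only: card_image[OF inj_on_csd_quaternion]) simp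
qed

end
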